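(* Let $(\Omega,*,I)$ be a commutative unital quantale and let $A$ be a completely distributive $\Omega$-lattice. Then the quotient algebras of $A$ correspond bijectively to the cocontinuous kernel operators on $A$.
   Context: A commutative unital quantale $(\Omega,*,I)$ is a complete lattice $\Omega$ with a commutative, associative binary operation $*$, monotone in each variable, with unit $I$ (not necessarily the top element), such that each $\alpha*(-)$ has a right adjoint $\alpha\to(-)$: $\alpha*\beta\le\gamma\iff\beta\le\alpha\to\gamma$. An $\Omega$-category is a set $A$ with a map $A(-,-):A\times A\to\Omega$ such that $I\le A(a,a)$ and $A(a,b)*A(b,c)\le A(a,c)$ for all $a,b,c\in A$. An $\Omega$-functor $f:A\to B$ is a function with $A(a,b)\le B(f(a),f(b))$ for all $a,b\in A$. The dual $A^{\rm op}$ is given by $A^{\rm op}(a,b)=A(b,a)$. $A$ is antisymmetric if $I\le A(a,b)$ and $I\le A(b,a)$ imply $a=b$. $\Omega$ is an $\Omega$-category via $\Omega(\alpha,\beta)=\alpha\to\beta$. $[A,B]$ is the $\Omega$-category of $\Omega$-functors from $A$ to $B$ with $[A,B](f,g)=\bigwedge_{x\in A}B(f(x),g(x))$. $\Omega$-functors $f:A\to B$ and $g:B\to A$ form an adjunction ($f$ is a left adjoint of $g$, $g$ is a right adjoint of $f$) if $B(f(a),b)=A(a,g(b))$ for all $a\in A$, $b\in B$. For a function $\phi:A\to\Omega$, a supremum $\sup\phi$ is an element $a\in A$ with $A(a,x)=\bigwedge_{z\in A}(\phi(z)\to A(z,x))$ for all $x\in A$. An $\Omega$-category $A$ is complete if the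 co-Yoneda embedding $A\to[A,\Omega]^{\rm op}$, $a\mapsto A(a,-)$, has a right adjoint; equivalently, the Yoneda embedding $A\to[A^{\rm op},\Omega]$, $a\mapsto A(-,a)$, has a left adjoint $\sup:[A^{\rm op},\Omega]\to A$; equivalently, every function $A\to\Omega$ has a supremum. A complete $\Omega$-lattice is an antisymmetric complete $\Omega$-category. A complete $\Omega$-lattice $A$ is completely distributive if the $\Omega$-functor $\sup:[A^{\rm op},\Omega]\to A$ has a left adjoint. For $\Omega$-categories $A$ and $B$, $B$ is a quotient algebra of $A$ if there is a surjective $\Omega$-functor $f:A\to B$ that has both a left adjoint and a right adjoint. A kernel operator on $A$ is an idempotent $\Omega$-functor $k:A\to A$ such that $A(k(x),x)\ge I$ for all $x\in A$. An $\Omega$-functor $f:A\to B$ is cocontinuous if it preserves sups: $f(\sup\mu)=\sup f(\mu)$ for every function $\mu:A\to\Omega$ whose supremum exists, where $f(\mu):B\to\Omega$ is given by $f(\mu)(b)=\bigvee_{x\in f^{-1}(b)}\mu(x)$. *)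

theory Defs
  imports Main "HOL-Library.FuncSet"
begin

class comm_unital_quantale = complete_lattice + comm_monoid_mult +
  fixes residual :: "'a \<Rightarrow> 'a \<Rightarrow> 'a"  (infixr "\<rightharpoonup>" 60)
  assumes residuation: "\<alpha> * \<beta> \<le> \<gamma> \<longleftrightarrow> \<beta> \<le> \<alpha> \<rightharpoonup> \<gamma>"

text \<open>Monotonicity of the multiplication need not be assumed separately.\<close>

lemma (in comm_unital_quantale) times_mono:
  assumes "\<alpha> \<le> \<alpha>'" and "\<beta> \<le> \<beta>'"
  shows "\<alpha> * \<beta> \<le> \<alpha>' * \<beta>'"
proof -
  have right: "x * y \<le> x * z" if "y \<le> z" for x y z
    using that residuation order_trans by blast
  have "\<alpha> * \<beta> \<le> \<alpha> * \<beta>'" using assms(2) by (rule right)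
  also have "\<dots> \<le> \<alpha>' * \<beta>'" using right[OF assms(1), of "\<beta>'"] by (simp add: mult.commute)
  finally show ?thesis .
qed

text \<open>
  The quantale is the whole type \<open>'w\<close> with unit \<open>1\<close>. Categories have an explicit set of objects,
  and functions between sets of objects are extensional functions, elements of \<open>_ \<rightarrow>\<^sub>E _\<close>, so that
  equality of functions in HOL is equality of functions between sets.
\<close>

record ('a, 'w) ocat =
  objs :: "'a set"
  ohom :: "'a \<Rightarrow> 'a \<Rightarrow> 'w"

definition is_ocat :: "('a, 'w::comm_unital_quantale) ocat \<Rightarrow> bool" where
  "is_ocat A \<longleftrightarrow>
     (\<forall>a\<in>objs A. 1 \<le> ohom A a a) \<and>
     (\<forall>a\<in>objs A. \<forall>b\<in>objs A. \<forall>c\<in>objs A. ohom A a b * ohom A b c \<le> ohom A a c)"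

definition op_cat :: "('a, 'w) ocat \<Rightarrow> ('a, 'w) ocat" where
  "op_cat A = \<lparr>objs = objs A, ohom = (\<lambda>a b. ohom A b a)\<rparr>"

definition quantale_cat :: "('w, 'w::comm_unital_quantale) ocat" where
  "quantale_cat = \<lparr>objs = UNIV, ohom = (\<lambda>\<alpha> \<beta>. \<alpha> \<rightharpoonup> \<beta>)\<rparr>"

definition isomorphic_objs :: "('a, 'w::comm_unital_quantale) ocat \<Rightarrow> 'a \<Rightarrow> 'a \<Rightarrow> bool" where
  "isomorphic_objs A a b \<longleftrightarrow> 1 \<le> ohom A a b \<and> 1 \<le> ohom A b a"

definition antisymmetric :: "('a, 'w::comm_unital_quantale) ocat \<Rightarrow> bool" where
  "antisymmetric A \<longleftrightarrow> (\<forall>a\<in>objs A. \<forall>b\<in>objs A. isomorphic_objs A a b \<longrightarrow> a = b)"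

definition ofunctors ::
  "('a, 'w::comm_unital_quantale) ocat \<Rightarrow> ('b, 'w) ocat \<Rightarrow> ('a \<Rightarrow> 'b) set" where
  "ofunctors A B = {f \<in> objs A \<rightarrow>\<^sub>E objs B.
     \<forall>a\<in>objs A. \<forall>b\<in>objs A. ohom A a b \<le> ohom B (f a) (f b)}"

definition functor_cat ::
  "('a, 'w::comm_unital_quantale) ocat \<Rightarrow> ('b, 'w) ocat \<Rightarrow> ('a \<Rightarrow> 'b, 'w) ocat" where
  "functor_cat A B =
     \<lparr>objs = ofunctors A B, ohom = (\<lambda>f g. INF x\<in>objs A. ohom B (f x) (g x))\<rparr>"

text \<open>\<open>adjunction A B f g\<close>: \<open>f\<close> is the left adjoint, \<open>g\<close> the right adjoint.\<close>

definition adjunction ::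
  "('a, 'w::comm_unital_quantale) ocat \<Rightarrow> ('b, 'w) ocat \<Rightarrow> ('a \<Rightarrow> 'b) \<Rightarrow> ('b \<Rightarrow> 'a) \<Rightarrow> bool" where
  "adjunction A B f g \<longleftrightarrow> f \<in> ofunctors A B \<and> g \<in> ofunctors B A \<and>
     (\<forall>a\<in>objs A. \<forall>b\<in>objs B. ohom B (f a) b = ohom A a (g b))"

definition yoneda :: "('a, 'w::comm_unital_quantale) ocat \<Rightarrow> 'a \<Rightarrow> 'a \<Rightarrow> 'w" where
  "yoneda A = (\<lambda>a\<in>objs A. \<lambda>x\<in>objs A. ohom A x a)"

definition coyoneda :: "('a, 'w::comm_unital_quantale) ocat \<Rightarrow> 'a \<Rightarrow> 'a \<Rightarrow> 'w" where
  "coyoneda A = (\<lambda>a\<in>objs A. \<lambda>x\<in>objs A. ohom A a x)"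

definition complete_ocat :: "('a, 'w::comm_unital_quantale) ocat \<Rightarrow> bool" where
  "complete_ocat A \<longleftrightarrow> is_ocat A \<and>
     (\<exists>r. adjunction A (op_cat (functor_cat A quantale_cat)) (coyoneda A) r)"

definition complete_olattice :: "('a, 'w::comm_unital_quantale) ocat \<Rightarrow> bool" where
  "complete_olattice A \<longleftrightarrow> complete_ocat A \<and> antisymmetric A"

definition completely_distributive_olattice ::
  "('a, 'w::comm_unital_quantale) ocat \<Rightarrow> bool" where
  "completely_distributive_olattice A \<longleftrightarrow> complete_olattice A \<and>
     (\<exists>sup. adjunction (functor_cat (op_cat A) quantale_cat) A sup (yoneda A) \<and>
        (\<exists>d. adjunction A (functor_cat (op_cat A) quantale_cat) d sup))"

text \<open>Only the values of \<open>\<phi>\<close> on \<open>objs A\<close> matter.\<close>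

definition is_osup ::
  "('a, 'w::comm_unital_quantale) ocat \<Rightarrow> ('a \<Rightarrow> 'w) \<Rightarrow> 'a \<Rightarrow> bool" where
  "is_osup A \<phi> a \<longleftrightarrow> a \<in> objs A \<and>
     (\<forall>x\<in>objs A. ohom A a x = (INF z\<in>objs A. \<phi> z \<rightharpoonup> ohom A z x))"

definition direct_image ::
  "('a, 'w::comm_unital_quantale) ocat \<Rightarrow> ('a \<Rightarrow> 'b) \<Rightarrow> ('a \<Rightarrow> 'w) \<Rightarrow> 'b \<Rightarrow> 'w" where
  "direct_image A f \<mu> b = (SUP x\<in>{x\<in>objs A. f x = b}. \<mu> x)"

definition cocontinuous ::
  "('a, 'w::comm_unital_quantale) ocat \<Rightarrow> ('b, 'w) ocat \<Rightarrow> ('a \<Rightarrow> 'b) \<Rightarrow> bool" where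
  "cocontinuous A B f \<longleftrightarrow> f \<in> ofunctors A B \<and>
     (\<forall>\<mu> a. is_osup A \<mu> a \<longrightarrow> is_osup B (direct_image A f \<mu>) (f a))"

definition kernel_operator ::
  "('a, 'w::comm_unital_quantale) ocat \<Rightarrow> ('a \<Rightarrow> 'a) \<Rightarrow> bool" where
  "kernel_operator A k \<longleftrightarrow> k \<in> ofunctors A A \<and>
     (\<forall>x\<in>objs A. k (k x) = k x) \<and> (\<forall>x\<in>objs A. 1 \<le> ohom A (k x) x)"

text \<open>
  A quotient algebra is a category together with a quotient map onto it, since different quotient
  maps with the same codomain may induce different kernel operators.
\<close>

definition quotient_algebra ::
  "('a, 'w::comm_unital_quantale) ocat \<Rightarrow> ('b, 'w) ocat \<Rightarrow> ('a \<Rightarrow> 'b) \<Rightarrow> bool" where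
  "quotient_algebra A B f \<longleftrightarrow> is_ocat B \<and> f \<in> ofunctors A B \<and> f ` objs A = objs B \<and>
     (\<exists>g. adjunction B A g f) \<and> (\<exists>h. adjunction A B f h)"

text \<open>
  Equivalence of categories under \<open>A\<close>. For antisymmetric \<open>B\<close> and \<open>C\<close> it is isomorphism under \<open>A\<close>.
\<close>

definition equivalent_under ::
  "('a, 'w::comm_unital_quantale) ocat \<Rightarrow> ('b, 'w) ocat \<times> ('a \<Rightarrow> 'b) \<Rightarrow>
     ('c, 'w) ocat \<times> ('a \<Rightarrow> 'c) \<Rightarrow> bool" where
  "equivalent_under A = (\<lambda>(B, f) (C, f').
     \<exists>h\<in>ofunctors B C. \<exists>h'\<in>ofunctors C B.
       (\<forall>b\<in>objs B. isomorphic_objs B (h' (h b)) b) \<and>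
       (\<forall>c\<in>objs C. isomorphic_objs C (h (h' c)) c) \<and>
       (\<forall>a\<in>objs A. isomorphic_objs C (h (f a)) (f' a)))"

text \<open>
  Quotient algebras of a lattice are meant to be lattices, so they are antisymmetric here. Without
  this they could only be classified up to equivalence: the codomain may be inflated by
  isomorphic copies of objects. As quotient maps are surjective, the type of objects of \<open>A\<close> is
  large enough to represent every quotient.
\<close>

definition quotient_algebras ::
  "('a, 'w::comm_unital_quantale) ocat \<Rightarrow> (('a, 'w) ocat \<times> ('a \<Rightarrow> 'a)) set" where
  "quotient_algebras A = {(B, f). quotient_algebra A B f \<and> antisymmetric B}"

definition ocat_isomorphisms ::
  "('b, 'w::comm_unital_quantale) ocat \<Rightarrow> ('c, 'w) ocat \<Rightarrow> ('b \<Rightarrow> 'c) set" where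
  "ocat_isomorphisms B C = {h \<in> ofunctors B C. bij_betw h (objs B) (objs C) \<and>
     (\<forall>x\<in>objs B. \<forall>y\<in>objs B. ohom C (h x) (h y) = ohom B x y)}"

definition quotient_isomorphism ::
  "('a, 'w::comm_unital_quantale) ocat \<Rightarrow>
     ((('a, 'w) ocat \<times> ('a \<Rightarrow> 'a)) \<times> (('a, 'w) ocat \<times> ('a \<Rightarrow> 'a))) set" where
  "quotient_isomorphism A = {((B, f), (C, f')).
     (B, f) \<in> quotient_algebras A \<and> (C, f') \<in> quotient_algebras A \<and>
     (\<exists>h\<in>ocat_isomorphisms B C. \<forall>a\<in>objs A. h (f a) = f' a)}"

definition cocontinuous_kernel_operators ::
  "('a, 'w::comm_unital_quantale) ocat \<Rightarrow> ('a \<Rightarrow> 'a) set" where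
  "cocontinuous_kernel_operators A = {k. kernel_operator A k \<and> cocontinuous A A k}"

end

theory Submission imports Defs begin

text \<open>
  A quotient map \<open>f: A \<rightarrow> B\<close> with adjoints \<open>g \<stileturn> f \<stileturn> h\<close> (left adjoints on the left) gives the
  operator \<open>k = g \<circ> f\<close> on \<open>A\<close>. Everything rests on the identity \<open>A(k a, x) = B(f a, f x)\<close>. Since \<open>f\<close>
  is surjective, the right-hand side contains the whole structure of \<open>B\<close>, and an antisymmetric \<open>B\<close>
  can be recovered from it up to a unique isomorphism under \<open>A\<close>; since \<open>A\<close> is antisymmetric, the
  left-hand side determines \<open>k\<close>. Hence two quotients are isomorphic if and only if they
  induce the same operator (\<open>quotient_isomorphism_iff\<close>).

  The counit of \<open>g \<stileturn> f\<close> makes \<open>k\<close> a kernel operator, and \<open>h \<circ> f\<close> is a right adjoint of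
  \<open>k\<close>, so that \<open>k\<close> preserves suprema (\<open>quotient_kernel\<close>).

  Conversely, a kernel operator \<open>k\<close> corestricts to a right adjoint of the inclusion of its image.
  If \<open>k\<close> is cocontinuous, then this corestriction also has a right adjoint, which sends \<open>b\<close> to the
  supremum of the presheaf \<open>A(k(-), b)\<close>; this is the adjoint functor theorem, and it uses that
  presheaves on \<open>A\<close> have suprema (\<open>kernel_image_quotient\<close>). So the image of \<open>k\<close> is a
  quotient that induces \<open>k\<close>.

  The same image represents a quotient \<open>B\<close> that need not be antisymmetric: \<open>g\<close> maps \<open>B\<close> into
  the image of \<open>k\<close>, and the restriction of \<open>f\<close> is inverse to it up to isomorphism of objects
  (\<open>quotient_equivalent_kernel_image\<close>).
\<close>

section \<open>Residuation and categories over a quantale\<close>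

lemma residual_self: "1 \<le> \<alpha> \<rightharpoonup> (\<alpha> :: 'w::comm_unital_quantale)"
  by (simp flip: residuation)

lemma residual_SUP:
  "(SUP i\<in>I. \<phi> i) \<rightharpoonup> \<gamma> = (INF i\<in>I. \<phi> i \<rightharpoonup> (\<gamma> :: 'w::comm_unital_quantale))"
proof -
  have swap: "\<beta> \<le> \<alpha> \<rightharpoonup> \<gamma> \<longleftrightarrow> \<alpha> \<le> \<beta> \<rightharpoonup> \<gamma>" for \<alpha> \<beta> :: 'w
    by (metis residuation mult.commute)
  have "\<beta> \<le> (SUP i\<in>I. \<phi> i) \<rightharpoonup> \<gamma> \<longleftrightarrow> \<beta> \<le> (INF i\<in>I. \<phi> i \<rightharpoonup> \<gamma>)" for \<beta>
  proof -
    have "\<beta> \<le> (SUP i\<in>I. \<phi> i) \<rightharpoonup> \<gamma> \<longleftrightarrow> (\<forall>i\<in>I. \<phi> i \<le> \<beta> \<rightharpoonup> \<gamma>)"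
      by (subst swap) (rule SUP_le_iff)
    also have "\<dots> \<longleftrightarrow> (\<forall>i\<in>I. \<beta> \<le> \<phi> i \<rightharpoonup> \<gamma>)"
      using swap by blast
    finally show ?thesis by (simp add: le_INF_iff)
  qed
  then show ?thesis
    by (meson order_antisym order_refl)
qed

text \<open>
  A direct image along \<open>f\<close> is the bottom element outside the range of \<open>f\<close>, where it contributes
  the top element to the infimum.
\<close>

lemma INF_direct_image:
  fixes A :: "('a, 'w::comm_unital_quantale) ocat"
  assumes "f \<in> objs A \<rightarrow> Y"
  shows "(INF b\<in>Y. direct_image A f \<mu> b \<rightharpoonup> \<phi> b) = (INF z\<in>objs A. \<mu> z \<rightharpoonup> \<phi> (f z))"
proof (rule antisym)
  show "(INF b\<in>Y. direct_image A f \<mu> b \<rightharpoonup> \<phi> b) \<le> (INF z\<in>objs A. \<mu> z \<rightharpoonup> \<phi> (f z))"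
  proof (rule INF_greatest)
    fix z assume z: "z \<in> objs A"
    have "(INF b\<in>Y. direct_image A f \<mu> b \<rightharpoonup> \<phi> b) \<le> direct_image A f \<mu> (f z) \<rightharpoonup> \<phi> (f z)"
      using assms z by (intro INF_lower) auto
    also have "\<dots> \<le> \<mu> z \<rightharpoonup> \<phi> (f z)"
      unfolding direct_image_def residual_SUP using z by (intro INF_lower) auto
    finally show "(INF b\<in>Y. direct_image A f \<mu> b \<rightharpoonup> \<phi> b) \<le> \<mu> z \<rightharpoonup> \<phi> (f z)" .
  qed
  show "(INF z\<in>objs A. \<mu> z \<rightharpoonup> \<phi> (f z)) \<le> (INF b\<in>Y. direct_image A f \<mu> b \<rightharpoonup> \<phi> b)"
    unfolding direct_image_def residual_SUP by (auto intro!: INF_greatest INF_lower2)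
qed

lemma ohom_refl: "is_ocat A \<Longrightarrow> a \<in> objs A \<Longrightarrow> 1 \<le> ohom A a a"
  by (simp add: is_ocat_def)

lemma ohom_trans:
  "is_ocat A \<Longrightarrow> a \<in> objs A \<Longrightarrow> b \<in> objs A \<Longrightarrow> c \<in> objs A \<Longrightarrow>
     ohom A a b * ohom A b c \<le> ohom A a c"
  by (simp add: is_ocat_def)

lemma ohom_precomp_mono:
  assumes "is_ocat A" "a \<in> objs A" "b \<in> objs A" "c \<in> objs A" "1 \<le> ohom A a b"
  shows "ohom A b c \<le> ohom A a c"
  using times_mono[OF assms(5) order_refl, of "ohom A b c"] ohom_trans[OF assms(1-4)]
  by simp

lemma ohom_postcomp_mono:
  assumes "is_ocat A" "a \<in> objs A" "b \<in> objs A" "c \<in> objs A" "1 \<le> ohom A b c"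
  shows "ohom A a b \<le> ohom A a c"
  using times_mono[OF order_refl assms(5), of "ohom A a b"] ohom_trans[OF assms(1-4)]
  by simp

lemma antisymmetricD:
  "antisymmetric A \<Longrightarrow> a \<in> objs A \<Longrightarrow> b \<in> objs A \<Longrightarrow>
     1 \<le> ohom A a b \<Longrightarrow> 1 \<le> ohom A b a \<Longrightarrow> a = b"
  by (simp add: antisymmetric_def isomorphic_objs_def)

text \<open>The Yoneda principle: an object of an antisymmetric category is determined by the maps out of it.\<close>

lemma eq_by_ohom:
  assumes "is_ocat A" "antisymmetric A" "a \<in> objs A" "b \<in> objs A"
    and "\<And>x. x \<in> objs A \<Longrightarrow> ohom A a x = ohom A b x"
  shows "a = b"
  using assms ohom_refl[OF assms(1)] by (metis antisymmetricD)

lemma ofunctors_objs: "f \<in> ofunctors A B \<Longrightarrow> a \<in> objs A \<Longrightarrow> f a \<in> objs B"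
  by (auto simp: ofunctors_def)

lemma ofunctors_ohom:
  "f \<in> ofunctors A B \<Longrightarrow> a \<in> objs A \<Longrightarrow> b \<in> objs A \<Longrightarrow> ohom A a b \<le> ohom B (f a) (f b)"
  by (auto simp: ofunctors_def)

lemma ofunctors_extensional: "f \<in> ofunctors A B \<Longrightarrow> f \<in> extensional (objs A)"
  by (auto simp: ofunctors_def PiE_def)

lemma ofunctorsI:
  assumes "\<And>a. a \<in> objs A \<Longrightarrow> f a \<in> objs B" "f \<in> extensional (objs A)"
    and "\<And>a b. a \<in> objs A \<Longrightarrow> b \<in> objs A \<Longrightarrow> ohom A a b \<le> ohom B (f a) (f b)"
  shows "f \<in> ofunctors A B"
  using assms by (auto simp: ofunctors_def PiE_def)

lemma compose_ofunctors:
  assumes f: "f \<in> ofunctors A B" and g: "g \<in> ofunctors B C"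
  shows "compose (objs A) g f \<in> ofunctors A C"
proof (rule ofunctorsI)
  fix a b assume "a \<in> objs A" "b \<in> objs A"
  then show "ohom A a b \<le> ohom C (compose (objs A) g f a) (compose (objs A) g f b)"
    using order_trans[OF ofunctors_ohom[OF f, of a b] ofunctors_ohom[OF g, of "f a" "f b"]]
      ofunctors_objs[OF f]
    by (simp add: compose_def)
qed (auto simp: compose_def ofunctors_objs[OF f] ofunctors_objs[OF g])

section \<open>Adjunctions\<close>

lemma adjunction_left: "adjunction A B f g \<Longrightarrow> f \<in> ofunctors A B"
  and adjunction_right: "adjunction A B f g \<Longrightarrow> g \<in> ofunctors B A"
  and adjunction_ohom: "adjunction A B f g \<Longrightarrow> a \<in> objs A \<Longrightarrow> b \<in> objs B \<Longrightarrow>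
    ohom B (f a) b = ohom A a (g b)"
  by (auto simp: adjunction_def)

lemma adjunction_compose:
  assumes "adjunction A B f f'" and "adjunction B C g g'"
  shows "adjunction A C (compose (objs A) g f) (compose (objs C) f' g')"
  unfolding adjunction_def
  using compose_ofunctors[OF adjunction_left[OF assms(1)] adjunction_left[OF assms(2)]]
    compose_ofunctors[OF adjunction_right[OF assms(2)] adjunction_right[OF assms(1)]]
    adjunction_ohom[OF assms(1)] adjunction_ohom[OF assms(2)]
    ofunctors_objs[OF adjunction_left[OF assms(1)]]
    ofunctors_objs[OF adjunction_right[OF assms(2)]]
  by (simp add: compose_def)

text \<open>
  A right adjoint of a functor may be chosen object by object: that the choices form a
  functor is automatic.
\<close>

lemma adjunctionI_pointwise:
  assumes "is_ocat A" "is_ocat B" "f \<in> ofunctors A B"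
    and g: "\<And>b. b \<in> objs B \<Longrightarrow> g b \<in> objs A" "g \<in> extensional (objs B)"
    and adj: "\<And>a b. a \<in> objs A \<Longrightarrow> b \<in> objs B \<Longrightarrow> ohom B (f a) b = ohom A a (g b)"
  shows "adjunction A B f g"
proof -
  have "g \<in> ofunctors B A"
  proof (rule ofunctorsI)
    fix b c assume b: "b \<in> objs B" and c: "c \<in> objs B"
    have "1 \<le> ohom B (f (g b)) b"
      using adj[of "g b" b] g(1) b ohom_refl[OF assms(1)] by simp
    then have "ohom B b c \<le> ohom B (f (g b)) c"
      using ofunctors_objs[OF assms(3) g(1)] b c by (intro ohom_precomp_mono[OF assms(2)]) auto
    then show "ohom B b c \<le> ohom A (g b) (g c)"
      using adj g(1) b c by simp
  qed (use g in auto)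
  then show ?thesis
    using assms(3) adj by (simp add: adjunction_def)
qed

lemma left_adjoint_cocontinuous:
  assumes "adjunction A B f g"
  shows "cocontinuous A B f"
  unfolding cocontinuous_def
proof (intro conjI allI impI)
  show f: "f \<in> ofunctors A B" using assms by (rule adjunction_left)
  fix \<mu> a assume sup: "is_osup A \<mu> a"
  then have a: "a \<in> objs A" by (simp add: is_osup_def)
  have "ohom B (f a) x = (INF b\<in>objs B. direct_image A f \<mu> b \<rightharpoonup> ohom B b x)"
    if x: "x \<in> objs B" for x
  proof -
    have gx: "g x \<in> objs A"
      using adjunction_right[OF assms] x by (rule ofunctors_objs)
    have "ohom B (f a) x = ohom A a (g x)"
      using adjunction_ohom[OF assms a x] .
    also have "\<dots> = (INF z\<in>objs A. \<mu> z \<rightharpoonup> ohom A z (g x))"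
      using sup gx by (simp add: is_osup_def)
    also have "\<dots> = (INF z\<in>objs A. \<mu> z \<rightharpoonup> ohom B (f z) x)"
      using adjunction_ohom[OF assms _ x] by simp
    also have "\<dots> = (INF b\<in>objs B. direct_image A f \<mu> b \<rightharpoonup> ohom B b x)"
      using f by (subst INF_direct_image) (auto dest: ofunctors_objs)
    finally show ?thesis .
  qed
  then show "is_osup B (direct_image A f \<mu>) (f a)"
    using ofunctors_objs[OF f a] by (simp add: is_osup_def)
qed

section \<open>The kernel operator of a quotient\<close>

text \<open>
  The identity \<open>A(g (f a), x) = B(f a, f x)\<close> in particular says that the operator
  \<open>g \<circ> f\<close> depends only on \<open>f\<close>, even though \<open>g\<close> is unique only up to isomorphism in general.
\<close>

lemma induced_ohom:
  assumes "adjunction B A g f" "a \<in> objs A" "x \<in> objs A"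
  shows "ohom A (compose (objs A) g f a) x = ohom B (f a) (f x)"
  using assms ofunctors_objs[OF adjunction_right[OF assms(1)]]
  by (simp add: compose_def adjunction_ohom)

text \<open>
  The counit holds because \<open>A(k x, x) = B(f x, f x)\<close>. Since \<open>B\<close> may have distinct isomorphic
  objects, \<open>f \<circ> g\<close> need not be the identity, so idempotence comes from antisymmetry of \<open>A\<close>:
  applying \<open>g\<close> to the unit \<open>1 \<le> B(b, f (g b))\<close> at \<open>b = f x\<close> gives the inequality opposite to
  the counit. Suprema are preserved because \<open>h \<circ> f\<close> is a right adjoint of \<open>g \<circ> f\<close>.
\<close>

lemma quotient_kernel:
  assumes A: "is_ocat A" "antisymmetric A" and q: "quotient_algebra A B f"
    and g: "adjunction B A g f"
  shows "compose (objs A) g f \<in> cocontinuous_kernel_operators A"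
proof -
  let ?k = "compose (objs A) g f"
  obtain h where h: "adjunction A B f h" and B: "is_ocat B"
    using q by (auto simp: quotient_algebra_def)
  have adj: "adjunction A A ?k (compose (objs A) h f)"
    using adjunction_compose[OF h g] .
  have k: "?k \<in> ofunctors A A" using adj by (rule adjunction_left)
  have f: "f x \<in> objs B" if "x \<in> objs A" for x
    using adjunction_right[OF g] that by (rule ofunctors_objs)
  have kx: "?k x \<in> objs A" if "x \<in> objs A" for x
    using k that by (rule ofunctors_objs)
  have counit: "1 \<le> ohom A (?k x) x" if x: "x \<in> objs A" for x
    using induced_ohom[OF g x x] ohom_refl[OF B f[OF x]] by simp
  have "?k (?k x) = ?k x" if x: "x \<in> objs A" for x
  proof (rule antisymmetricD[OF A(2)])
    show "1 \<le> ohom A (?k (?k x)) (?k x)" using counit kx x by blast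
    have "1 \<le> ohom A (g (f x)) (g (f x))"
      using ohom_refl[OF A(1) kx[OF x]] x by (simp add: compose_def)
    also have "\<dots> = ohom B (f x) (f (g (f x)))"
      using adjunction_ohom[OF g f[OF x] kx[OF x]] x by (simp add: compose_def)
    also have "\<dots> \<le> ohom A (g (f x)) (g (f (g (f x))))"
      using adjunction_left[OF g] f[OF x] f[OF kx[OF x]] x
      by (intro ofunctors_ohom) (auto simp: compose_def)
    also have "\<dots> = ohom A (?k x) (?k (?k x))"
      using x kx[OF x] by (simp add: compose_def)
    finally show "1 \<le> ohom A (?k x) (?k (?k x))" .
  qed (use kx x in auto)
  then show ?thesis
    using k counit left_adjoint_cocontinuous[OF adj]
    by (simp add: cocontinuous_kernel_operators_def kernel_operator_def)
qed

text \<open>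
  The left adjoint of the quotient map is chosen arbitrarily here; the resulting operator
  does not depend on the choice when \<open>A\<close> is antisymmetric.
\<close>

definition quotient_operator ::
  "('a, 'w::comm_unital_quantale) ocat \<Rightarrow> ('a, 'w) ocat \<times> ('a \<Rightarrow> 'a) \<Rightarrow> 'a \<Rightarrow> 'a" where
  "quotient_operator A = (\<lambda>(B, f). compose (objs A) (SOME g. adjunction B A g f) f)"

lemma quotient_operator_eq_iff:
  assumes A: "is_ocat A" "antisymmetric A"
    and g: "adjunction B A g f" and g': "adjunction C A g' f'"
  shows "compose (objs A) g f = compose (objs A) g' f' \<longleftrightarrow>
    (\<forall>a\<in>objs A. \<forall>x\<in>objs A. ohom B (f a) (f x) = ohom C (f' a) (f' x))"
proof
  assume "compose (objs A) g f = compose (objs A) g' f'"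
  then show "\<forall>a\<in>objs A. \<forall>x\<in>objs A. ohom B (f a) (f x) = ohom C (f' a) (f' x)"
    using induced_ohom[OF g] induced_ohom[OF g'] by metis
next
  assume eq: "\<forall>a\<in>objs A. \<forall>x\<in>objs A. ohom B (f a) (f x) = ohom C (f' a) (f' x)"
  show "compose (objs A) g f = compose (objs A) g' f'"
  proof (rule extensionalityI[OF compose_extensional compose_extensional])
    fix a assume a: "a \<in> objs A"
    show "compose (objs A) g f a = compose (objs A) g' f' a"
    proof (rule eq_by_ohom[OF A])
      show "compose (objs A) g f a \<in> objs A"
        using compose_ofunctors[OF adjunction_right[OF g] adjunction_left[OF g]] a
        by (rule ofunctors_objs)
      show "compose (objs A) g' f' a \<in> objs A"
        using compose_ofunctors[OF adjunction_right[OF g'] adjunction_left[OF g']] a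
        by (rule ofunctors_objs)
    qed (use eq a induced_ohom[OF g a] induced_ohom[OF g' a] in simp)
  qed
qed

lemma quotient_operator_eq:
  assumes "is_ocat A" "antisymmetric A" and g: "adjunction B A g f"
  shows "quotient_operator A (B, f) = compose (objs A) g f"
proof -
  have "adjunction B A (SOME g. adjunction B A g f) f"
    using g by (rule someI[of "\<lambda>g. adjunction B A g f"])
  from quotient_operator_eq_iff[OF assms(1,2) this g] show ?thesis
    by (simp add: quotient_operator_def)
qed

text \<open>
  If \<open>B(f a, f x) = C(f' a, f' x)\<close> throughout, then \<open>f a \<mapsto> f' a\<close> is a well defined injection,
  because antisymmetry expresses equality of objects through the hom-values; surjectivity of the
  quotient maps makes it a bijection of \<open>B\<close> with \<open>C\<close>.
\<close>

lemma quotient_isomorphism_iff_ohom: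
  assumes B: "(B, f) \<in> quotient_algebras A" and C: "(C, f') \<in> quotient_algebras A"
  shows "((B, f), (C, f')) \<in> quotient_isomorphism A \<longleftrightarrow>
    (\<forall>a\<in>objs A. \<forall>x\<in>objs A. ohom B (f a) (f x) = ohom C (f' a) (f' x))"
proof
  have f: "f \<in> ofunctors A B" "f ` objs A = objs B" "is_ocat B" "antisymmetric B"
    using B by (auto simp: quotient_algebras_def quotient_algebra_def)
  have f': "f' \<in> ofunctors A C" "f' ` objs A = objs C" "is_ocat C" "antisymmetric C"
    using C by (auto simp: quotient_algebras_def quotient_algebra_def)
  {
    assume "((B, f), (C, f')) \<in> quotient_isomorphism A"
    then obtain h where h: "h \<in> ocat_isomorphisms B C" "\<forall>a\<in>objs A. h (f a) = f' a"
      by (auto simp: quotient_isomorphism_def)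
    have hf: "f' a = h (f a)" if "a \<in> objs A" for a
      using h(2) that by simp
    have hom: "ohom C (h b) (h c) = ohom B b c" if "b \<in> objs B" "c \<in> objs B" for b c
      using h(1) that by (simp add: ocat_isomorphisms_def)
    show "\<forall>a\<in>objs A. \<forall>x\<in>objs A. ohom B (f a) (f x) = ohom C (f' a) (f' x)"
      using ofunctors_objs[OF f(1)] by (simp add: hf hom)
  }
  assume eq: "\<forall>a\<in>objs A. \<forall>x\<in>objs A. ohom B (f a) (f x) = ohom C (f' a) (f' x)"
  have iff: "f a = f x \<longleftrightarrow> f' a = f' x" if ax: "a \<in> objs A" "x \<in> objs A" for a x
  proof
    assume "f a = f x"
    then have "1 \<le> ohom C (f' a) (f' x)" "1 \<le> ohom C (f' x) (f' a)"
      using eq ax ohom_refl[OF f(3) ofunctors_objs[OF f(1) ax(1)]]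
      by (simp_all flip: eq[rule_format])
    then show "f' a = f' x"
      using ax f'(1) by (intro antisymmetricD[OF f'(4)]) (auto dest: ofunctors_objs)
  next
    assume "f' a = f' x"
    then have "1 \<le> ohom B (f a) (f x)" "1 \<le> ohom B (f x) (f a)"
      using eq ax ohom_refl[OF f'(3) ofunctors_objs[OF f'(1) ax(1)]] by simp_all
    then show "f a = f x"
      using ax f(1) by (intro antisymmetricD[OF f(4)]) (auto dest: ofunctors_objs)
  qed
  define h where "h = (\<lambda>b\<in>objs B. f' (inv_into (objs A) f b))"
  have hf: "h (f a) = f' a" if a: "a \<in> objs A" for a
  proof -
    have fa: "f a \<in> f ` objs A" using a by simp
    have "inv_into (objs A) f (f a) \<in> objs A" "f (inv_into (objs A) f (f a)) = f a"
      using inv_into_into[OF fa] f_inv_into_f[OF fa] by auto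
    then show ?thesis
      using iff[of "inv_into (objs A) f (f a)" a] a fa f(2) by (simp add: h_def)
  qed
  have hom: "ohom C (h b) (h c) = ohom B b c" if "b \<in> objs B" "c \<in> objs B" for b c
    using that hf eq by (auto simp flip: f(2))
  have "h \<in> ofunctors B C"
  proof (rule ofunctorsI)
    show "h b \<in> objs C" if "b \<in> objs B" for b
      using that hf ofunctors_objs[OF f'(1)] by (auto simp flip: f(2))
  qed (simp add: h_def, simp add: hom)
  moreover have "bij_betw h (objs B) (objs C)"
    using hf iff by (auto simp: bij_betw_def inj_on_def image_image simp flip: f(2) f'(2))
  ultimately have "h \<in> ocat_isomorphisms B C"
    using hom by (simp add: ocat_isomorphisms_def)
  then show "((B, f), (C, f')) \<in> quotient_isomorphism A"
    using B C hf by (auto simp: quotient_isomorphism_def)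
qed

lemma quotient_isomorphism_iff:
  assumes A: "is_ocat A" "antisymmetric A"
  shows "(p, q) \<in> quotient_isomorphism A \<longleftrightarrow>
    p \<in> quotient_algebras A \<and> q \<in> quotient_algebras A \<and>
    quotient_operator A p = quotient_operator A q"
proof -
  obtain B f C f' where pq: "p = (B, f)" "q = (C, f')" by (metis surj_pair)
  show ?thesis
  proof (cases "p \<in> quotient_algebras A \<and> q \<in> quotient_algebras A")
    case False
    then show ?thesis by (auto simp: quotient_isomorphism_def)
  next
    case True
    then have mem: "(B, f) \<in> quotient_algebras A" "(C, f') \<in> quotient_algebras A"
      using pq by auto
    then obtain g g' where g: "adjunction B A g f" and g': "adjunction C A g' f'"
      by (auto simp: quotient_algebras_def quotient_algebra_def)
    have "(p, q) \<in> quotient_isomorphism A \<longleftrightarrow> quotient_operator A p = quotient_operator A q"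
      unfolding pq quotient_operator_eq[OF A g] quotient_operator_eq[OF A g']
        quotient_operator_eq_iff[OF A g g'] using mem by (rule quotient_isomorphism_iff_ohom)
    then show ?thesis using True by simp
  qed
qed

section \<open>The quotient of a cocontinuous kernel operator\<close>

definition kernel_image ::
  "('a, 'w::comm_unital_quantale) ocat \<Rightarrow> ('a \<Rightarrow> 'a) \<Rightarrow> ('a, 'w) ocat" where
  "kernel_image A k = \<lparr>objs = k ` objs A, ohom = ohom A\<rparr>"

lemma kernel_image_simps [simp]:
  "objs (kernel_image A k) = k ` objs A" "ohom (kernel_image A k) = ohom A"
  by (simp_all add: kernel_image_def)

text \<open>
  The adjunction identity of a left adjoint of the Yoneda embedding, evaluated at \<open>\<mu>\<close>, is the
  defining equation of a supremum of \<open>\<mu>\<close>.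
\<close>

lemma presheaf_sup_exists:
  assumes "adjunction (functor_cat (op_cat A) quantale_cat) A s (yoneda A)"
    and "\<mu> \<in> ofunctors (op_cat A) quantale_cat"
  shows "is_osup A \<mu> (s \<mu>)"
  using adjunction_ohom[OF assms(1), of \<mu>] ofunctors_objs[OF adjunction_left[OF assms(1)], of \<mu>]
    assms(2)
  by (simp add: is_osup_def functor_cat_def op_cat_def quantale_cat_def yoneda_def)

lemma osup_upper:
  assumes "is_ocat A" "is_osup A \<mu> a" "z \<in> objs A"
  shows "\<mu> z \<le> ohom A z a"
proof -
  have a: "a \<in> objs A" using assms(2) by (simp add: is_osup_def)
  have "1 \<le> ohom A a a" using assms(1) a by (rule ohom_refl)
  also have "\<dots> = (INF z\<in>objs A. \<mu> z \<rightharpoonup> ohom A z a)"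
    using assms(2) a by (simp add: is_osup_def)
  also have "\<dots> \<le> \<mu> z \<rightharpoonup> ohom A z a" using assms(3) by (rule INF_lower)
  finally show ?thesis by (simp flip: residuation)
qed

text \<open>
  The candidate value at \<open>b\<close> of a right adjoint of \<open>k\<close> is the supremum \<open>s\<close> of \<open>A(k(-), b)\<close>:
  as an upper bound it satisfies \<open>A(k x, b) \<le> A(x, s)\<close>, and as \<open>k\<close> preserves the supremum,
  \<open>A(k s, b)\<close> is an infimum of values \<open>A(k z, b) \<rightharpoonup> A(k z, b)\<close>, hence above the unit.
\<close>

lemma cocontinuous_adjoint_value:
  assumes A: "is_ocat A" and k: "cocontinuous A A k"
    and sups: "adjunction (functor_cat (op_cat A) quantale_cat) A s (yoneda A)"
    and b: "b \<in> objs A"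
  shows "\<exists>c\<in>objs A. \<forall>x\<in>objs A. ohom A (k x) b = ohom A x c"
proof -
  have kf: "k \<in> ofunctors A A" using k by (simp add: cocontinuous_def)
  note kx = ofunctors_objs[OF kf]
  define \<mu> where "\<mu> = (\<lambda>x\<in>objs A. ohom A (k x) b)"
  have "\<mu> \<in> ofunctors (op_cat A) quantale_cat"
  proof (rule ofunctorsI)
    fix x y assume "x \<in> objs (op_cat A)" "y \<in> objs (op_cat A)"
    then have xy: "x \<in> objs A" "y \<in> objs A" by (simp_all add: op_cat_def)
    have "ohom A y x * ohom A (k x) b \<le> ohom A (k y) (k x) * ohom A (k x) b"
      using ofunctors_ohom[OF kf xy(2,1)] by (intro times_mono) auto
    also have "\<dots> \<le> ohom A (k y) b"
      using A kx xy b by (intro ohom_trans) auto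
    finally have "ohom A (k x) b * ohom A y x \<le> ohom A (k y) b" by (simp add: mult.commute)
    then show "ohom (op_cat A) x y \<le> ohom quantale_cat (\<mu> x) (\<mu> y)"
      using xy by (simp add: op_cat_def quantale_cat_def \<mu>_def residuation)
  qed (auto simp: quantale_cat_def op_cat_def \<mu>_def)
  then obtain c where c: "is_osup A \<mu> c"
    using presheaf_sup_exists[OF sups] by blast
  then have c_obj: "c \<in> objs A" by (simp add: is_osup_def)
  have "is_osup A (direct_image A k \<mu>) (k c)"
    using k c by (simp add: cocontinuous_def)
  then have "ohom A (k c) b = (INF z\<in>objs A. direct_image A k \<mu> z \<rightharpoonup> ohom A z b)"
    using b by (simp add: is_osup_def)
  also have "\<dots> = (INF z\<in>objs A. \<mu> z \<rightharpoonup> ohom A (k z) b)"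
    using kx by (intro INF_direct_image) auto
  also have "\<dots> \<ge> 1" by (auto intro!: INF_greatest simp: \<mu>_def residual_self)
  finally have kc: "1 \<le> ohom A (k c) b" .
  show ?thesis
  proof (intro bexI[OF _ c_obj] ballI antisym)
    fix x assume x: "x \<in> objs A"
    show "ohom A (k x) b \<le> ohom A x c"
      using osup_upper[OF A c x] x by (simp add: \<mu>_def)
    have "ohom A x c \<le> ohom A (k x) (k c)" using kf x c_obj by (rule ofunctors_ohom)
    also have "\<dots> \<le> ohom A (k x) b"
      using A kx[OF x] kx[OF c_obj] b kc by (rule ohom_postcomp_mono)
    finally show "ohom A x c \<le> ohom A (k x) b" .
  qed
qed

lemma kernel_operator_ohom:
  assumes A: "is_ocat A" and k: "kernel_operator A k" and ax: "a \<in> objs A" "x \<in> objs A"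
  shows "ohom A (k a) (k x) = ohom A (k a) x"
proof (rule antisym)
  have kf: "k \<in> ofunctors A A" and idem: "k (k a) = k a" and counit: "1 \<le> ohom A (k x) x"
    using k ax by (auto simp: kernel_operator_def)
  note kx = ofunctors_objs[OF kf]
  show "ohom A (k a) (k x) \<le> ohom A (k a) x"
    using A kx[OF ax(1)] kx[OF ax(2)] ax(2) counit by (rule ohom_postcomp_mono)
  show "ohom A (k a) x \<le> ohom A (k a) (k x)"
    using ofunctors_ohom[OF kf kx[OF ax(1)] ax(2)] idem by simp
qed

lemma kernel_image_inclusion_adjoint:
  assumes A: "is_ocat A" and k: "kernel_operator A k"
  shows "adjunction (kernel_image A k) A (\<lambda>b\<in>k ` objs A. b) k"
  unfolding adjunction_def
proof (intro conjI ballI)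
  have kf: "k \<in> ofunctors A A" using k by (simp add: kernel_operator_def)
  show "(\<lambda>b\<in>k ` objs A. b) \<in> ofunctors (kernel_image A k) A"
    using ofunctors_objs[OF kf] by (intro ofunctorsI) auto
  show "k \<in> ofunctors A (kernel_image A k)"
    using ofunctors_ohom[OF kf] ofunctors_extensional[OF kf] by (intro ofunctorsI) auto
qed (auto simp: kernel_operator_ohom[OF A k])

lemma kernel_image_quotient:
  assumes A: "is_ocat A" "antisymmetric A"
    and sups: "adjunction (functor_cat (op_cat A) quantale_cat) A s (yoneda A)"
    and k: "k \<in> cocontinuous_kernel_operators A"
  shows "(kernel_image A k, k) \<in> quotient_algebras A"
    and "quotient_operator A (kernel_image A k, k) = k"
proof -
  have ker: "kernel_operator A k" and coc: "cocontinuous A A k"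
    using k by (auto simp: cocontinuous_kernel_operators_def)
  have kf: "k \<in> ofunctors A A" using ker by (simp add: kernel_operator_def)
  note kx = ofunctors_objs[OF kf]
  note incl = kernel_image_inclusion_adjoint[OF A(1) ker]
  have im: "is_ocat (kernel_image A k)"
    using A(1) kx by (auto simp: is_ocat_def)
  have anti: "antisymmetric (kernel_image A k)"
    using A(2) kx by (auto simp: antisymmetric_def isomorphic_objs_def)
  have "\<forall>b\<in>k ` objs A. \<exists>c. c \<in> objs A \<and> (\<forall>x\<in>objs A. ohom A (k x) b = ohom A x c)"
    using cocontinuous_adjoint_value[OF A(1) coc sups] kx by blast
  then obtain r where
    r: "\<forall>b\<in>k ` objs A. r b \<in> objs A \<and> (\<forall>x\<in>objs A. ohom A (k x) b = ohom A x (r b))"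
    by metis
  have "adjunction A (kernel_image A k) k (restrict r (k ` objs A))"
    using A(1) im adjunction_right[OF incl] by (rule adjunctionI_pointwise) (use r in auto)
  then show "(kernel_image A k, k) \<in> quotient_algebras A"
    using im anti incl adjunction_right[OF incl]
    by (auto simp: quotient_algebras_def quotient_algebra_def)
  have "compose (objs A) (\<lambda>b\<in>k ` objs A. b) k = k"
    using ofunctors_extensional[OF kf]
    by (intro extensionalityI[OF compose_extensional]) (auto simp: compose_def)
  then show "quotient_operator A (kernel_image A k, k) = k"
    using quotient_operator_eq[OF A incl] by simp
qed

lemma quotient_equivalent_kernel_image:
  assumes A: "is_ocat A" "antisymmetric A" and q: "quotient_algebra A B f"
    and g: "adjunction B A g f" and k: "k = compose (objs A) g f"
  shows "equivalent_under A (B, f) (kernel_image A k, k)"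
proof -
  have f: "f \<in> ofunctors A B" and B: "is_ocat B" and surj: "objs B = f ` objs A"
    using q by (auto simp: quotient_algebra_def)
  have ker: "kernel_operator A k"
    using quotient_kernel[OF A q g] k by (simp add: cocontinuous_kernel_operators_def)
  then have kf: "k \<in> ofunctors A A" and idem: "\<And>x. x \<in> objs A \<Longrightarrow> k (k x) = k x"
    and counit: "\<And>x. x \<in> objs A \<Longrightarrow> 1 \<le> ohom A (k x) x"
    by (auto simp: kernel_operator_def)
  note kx = ofunctors_objs[OF kf]
  have gf: "g (f a) = k a" if "a \<in> objs A" for a
    using that by (simp add: k compose_def)
  have hom: "ohom B (f a) (f x) = ohom A (k a) x" if "a \<in> objs A" "x \<in> objs A" for a x
    using induced_ohom[OF g that] k by simp
  let ?f = "restrict f (k ` objs A)"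
  show ?thesis
    unfolding equivalent_under_def prod.case
  proof (intro bexI conjI ballI)
    show "g \<in> ofunctors B (kernel_image A k)"
      using adjunction_left[OF g] gf surj
      by (intro ofunctorsI) (auto dest: ofunctors_extensional ofunctors_ohom)
    show "?f \<in> ofunctors (kernel_image A k) B"
      using f kx by (intro ofunctorsI) (auto dest: ofunctors_objs ofunctors_ohom)
    fix b assume "b \<in> objs B"
    then obtain a where a: "a \<in> objs A" "b = f a" using surj by auto
    have "1 \<le> ohom B (f (k a)) (f a)" "1 \<le> ohom B (f a) (f (k a))"
      using hom[of "k a" a] hom[of a "k a"] a(1) kx idem counit[OF a(1)]
        ohom_refl[OF A(1) kx[OF a(1)]] by auto
    then show "isomorphic_objs B (?f (g b)) b"
      using a gf by (simp add: isomorphic_objs_def)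
  next
    fix c assume "c \<in> objs (kernel_image A k)"
    then obtain a where a: "a \<in> objs A" "c = k a" by auto
    then show "isomorphic_objs (kernel_image A k) (g (?f c)) c"
      using gf[OF kx[OF a(1)]] idem kx ohom_refl[OF A(1)] by (simp add: isomorphic_objs_def)
  next
    fix a assume a: "a \<in> objs A"
    then show "isomorphic_objs (kernel_image A k) (g (f a)) (k a)"
      using gf kx ohom_refl[OF A(1)] by (simp add: isomorphic_objs_def)
  qed
qed

section \<open>The correspondence\<close>

text \<open>
  The bijection takes a class to the single value that \<open>c\<close> has on it. The second conclusion is what
  later identifies the operator assigned to a class from any of its representatives.
\<close>

lemma bij_betw_quotient_of_surj:
  assumes r: "\<And>x y. (x, y) \<in> r \<longleftrightarrow> x \<in> S \<and> y \<in> S \<and> c x = c y"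
    and surj: "c ` S = T"
  obtains \<Phi> where "bij_betw \<Phi> (S // r) T" "\<And>x. x \<in> S \<Longrightarrow> \<Phi> (r `` {x}) = c x"
proof -
  have image: "the_elem (c ` (r `` {x})) = c x" if "x \<in> S" for x
  proof -
    have "c ` (r `` {x}) = {c x}" using that by (auto simp: r)
    then show ?thesis by simp
  qed
  have "bij_betw (\<lambda>X. the_elem (c ` X)) (S // r) T"
    unfolding bij_betw_def
  proof
    show "inj_on (\<lambda>X. the_elem (c ` X)) (S // r)"
      by (auto intro!: inj_onI elim!: quotientE simp: image r)
    show "(\<lambda>X. the_elem (c ` X)) ` (S // r) = T"
      using surj by (auto simp: quotient_def image image_iff intro!: bexI)
  qed
  then show thesis using image by (rule that)
qed

theorem proposition5p12:
  fixes A :: "('a, 'w::comm_unital_quantale) ocat"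
  assumes "completely_distributive_olattice A"
  shows "(\<exists>\<Phi>. bij_betw \<Phi> (quotient_algebras A // quotient_isomorphism A)
                 (cocontinuous_kernel_operators A) \<and>
            (\<forall>(B, f)\<in>quotient_algebras A. \<forall>g. adjunction B A g f \<longrightarrow>
               \<Phi> (quotient_isomorphism A `` {(B, f)}) = compose (objs A) g f))
       \<and> (\<forall>(B :: ('b, 'w) ocat) f. quotient_algebra A B f \<longrightarrow>
            (\<exists>(B', f')\<in>quotient_algebras A. equivalent_under A (B, f) (B', f')))"
proof -
  have A: "is_ocat A" "antisymmetric A"
    using assms unfolding completely_distributive_olattice_def complete_olattice_def
      complete_ocat_def by auto
  obtain s where sups: "adjunction (functor_cat (op_cat A) quantale_cat) A s (yoneda A)"
    using assms unfolding completely_distributive_olattice_def by auto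
  have surj: "quotient_operator A ` quotient_algebras A = cocontinuous_kernel_operators A"
  proof
    show "quotient_operator A ` quotient_algebras A \<subseteq> cocontinuous_kernel_operators A"
    proof clarify
      fix B f assume "(B, f) \<in> quotient_algebras A"
      then obtain g where q: "quotient_algebra A B f" and g: "adjunction B A g f"
        by (auto simp: quotient_algebras_def quotient_algebra_def)
      show "quotient_operator A (B, f) \<in> cocontinuous_kernel_operators A"
        using quotient_kernel[OF A q g] quotient_operator_eq[OF A g] by simp
    qed
    show "cocontinuous_kernel_operators A \<subseteq> quotient_operator A ` quotient_algebras A"
      using kernel_image_quotient[OF A sups] by (metis image_eqI subsetI)
  qed
  obtain \<Phi> where \<Phi>: "bij_betw \<Phi> (quotient_algebras A // quotient_isomorphism A)
      (cocontinuous_kernel_operators A)"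
    "\<And>p. p \<in> quotient_algebras A \<Longrightarrow>
      \<Phi> (quotient_isomorphism A `` {p}) = quotient_operator A p"
    using bij_betw_quotient_of_surj[OF quotient_isomorphism_iff[OF A] surj] by blast
  have "\<forall>(B, f)\<in>quotient_algebras A. \<forall>g. adjunction B A g f \<longrightarrow>
      \<Phi> (quotient_isomorphism A `` {(B, f)}) = compose (objs A) g f"
    using \<Phi>(2) quotient_operator_eq[OF A] by auto
  moreover have "\<exists>(B', f')\<in>quotient_algebras A. equivalent_under A (B, f) (B', f')"
    if q: "quotient_algebra A B f" for B :: "('b, 'w) ocat" and f
  proof -
    obtain g where g: "adjunction B A g f" using q by (auto simp: quotient_algebra_def)
    let ?k = "compose (objs A) g f"
    have "(kernel_image A ?k, ?k) \<in> quotient_algebras A"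
      using kernel_image_quotient(1)[OF A sups quotient_kernel[OF A q g]] .
    moreover have "equivalent_under A (B, f) (kernel_image A ?k, ?k)"
      using quotient_equivalent_kernel_image[OF A q g refl] .
    ultimately show ?thesis by blast
  qed
  ultimately show ?thesis using \<Phi>(1) by blast
qed

end
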